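(* Let $X,Y$ be real reflexive Banach spaces and $C\subseteq X$, $K\subseteq Y$ closed convex cones, both different from $\{0\}$, such that $C^*$ and $K^*$ have non-empty interior. The following are equivalent: (i) For every $\alpha\in\mathrm{int}\,C^*$, every $\beta\in\mathrm{int}\,K^*$ and every linear operator $A:X\to Y^*$ such that the game $G=(\alpha,\beta,A)$ has finite lower and upper values, the minimax equality $$\max_{x\in S}\min_{y\in T}\langle y,Ax\rangle=\min_{y\in T}\max_{x\in S}\langle y,Ax\rangle$$ holds, where $S=\{x\in C:\langle\alpha,x\rangle=1\}$ and $T=\{y\in K:\langle y,\beta\rangle=1\}$. (ii) For every linear operator $A:X\to Y^*$, exactly one of (a), (b) holds and exactly one of (c), (d) holds, where (a) there exists $y\in K\setminus\{0\}$ such that $-A^*y\in C^*$; (b) there exists $x\in C\setminus\{0\}$ such that $Ax\in\mathrm{int}\,K^*$; (c) there exists $y\in K\setminus\{0\}$ such that $-A^*y\in\mathrm{int}\,C^*$; (d) there exists $x\in C\setminus\{0\}$ such that $Ax\in K^*$.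
   Context: $X^*$, $Y^*$ are the continuous duals; $\langle w,x\rangle$ ($w\in X^*,x\in X$) and $\langle y,z\rangle$ ($y\in Y,z\in Y^*$) are the canonical pairings; all spaces carry their norm topologies. A convex cone is a set $C$ with $\lambda C\subseteq C$ for all $\lambda\ge0$ and $\kappa C+(1-\kappa)C\subseteq C$ for all $\kappa\in[0,1]$. $C^*=\{w\in X^*:\langle w,x\rangle\ge0\ \forall x\in C\}$, $K^*=\{z\in Y^*:\langle y,z\rangle\ge0\ \forall y\in K\}$. Linear operators $A:X\to Y^*$ are always assumed to have an adjoint: for every $y\in Y$ there is a unique $A^*y\in X^*$ with $\langle A^*y,x\rangle=\langle y,Ax\rangle$ for all $x\in X$. $G=(\alpha,\beta,A)$ denotes the two-player zero-sum game with strategy sets $S$, $T$ as in the claim and payoff $u(x,y)=\langle y,Ax\rangle$ (player I maximizes over $S$, player II minimizes over $T$); its lower value is $\sup_{x\in S}\inf_{y\in T}u(x,y)$ and its upper value is $\inf_{y\in T}\sup_{x\in S}u(x,y)$. *)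

theory Defs
  imports "HOL-Analysis.Analysis"
begin

text \<open>
  The continuous dual of a real normed space \<open>'a\<close> is the type of bounded linear functionals below,
  with the operator norm; \<open>\<langle>w, x\<rangle>\<close> is \<^term>\<open>blinfun_apply\<close>, inserted as a coercion.
\<close>

type_synonym 'a dual = "'a \<Rightarrow>\<^sub>L real"

text \<open>The canonical embedding into the bidual is onto.\<close>

definition reflexive_space :: "'a::real_normed_vector itself \<Rightarrow> bool" where
  "reflexive_space _ \<longleftrightarrow>
     (\<forall>\<phi> :: 'a dual dual. \<exists>x::'a. \<forall>w :: 'a dual. blinfun_apply \<phi> w = blinfun_apply w x)"

definition dual_cone :: "'a::real_normed_vector set \<Rightarrow> 'a dual set" where
  "dual_cone C = {w. \<forall>x\<in>C. 0 \<le> blinfun_apply w x}"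

text \<open>
  Linear operators from \<open>X\<close> to \<open>Y\<^sup>*\<close> that possess an adjoint from \<open>Y\<close> to \<open>X\<^sup>*\<close>.
  Continuity is not part of the definition.
\<close>

definition operator_with_adjoint ::
    "('a::real_normed_vector \<Rightarrow> 'b::real_normed_vector dual) \<Rightarrow> bool" where
  "operator_with_adjoint A \<longleftrightarrow>
     linear A \<and> (\<forall>y. \<exists>!w :: 'a dual. \<forall>x. blinfun_apply w x = blinfun_apply (A x) y)"

definition dual_adjoint ::
    "('a::real_normed_vector \<Rightarrow> 'b::real_normed_vector dual) \<Rightarrow> 'b \<Rightarrow> 'a dual" where
  "dual_adjoint A y = (THE w. \<forall>x. blinfun_apply w x = blinfun_apply (A x) y)"

lemma dual_adjoint_apply:
  assumes "operator_with_adjoint A"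
  shows "blinfun_apply (dual_adjoint A y) x = blinfun_apply (A x) y"
proof -
  have "\<exists>!w. \<forall>x. blinfun_apply w x = blinfun_apply (A x) y"
    using assms unfolding operator_with_adjoint_def by blast
  from theI'[OF this] show ?thesis
    unfolding dual_adjoint_def by blast
qed

definition strategies :: "'a::real_normed_vector set \<Rightarrow> 'a dual \<Rightarrow> 'a set" where
  "strategies C \<alpha> = {x \<in> C. blinfun_apply \<alpha> x = 1}"

definition payoff ::
    "('a::real_normed_vector \<Rightarrow> 'b::real_normed_vector dual) \<Rightarrow> 'a \<Rightarrow> 'b \<Rightarrow> real" where
  "payoff A x y = blinfun_apply (A x) y"

text \<open>The values are extended reals, since the extrema need not be finite a priori.\<close>

definition lower_value :: "'a set \<Rightarrow> 'b set \<Rightarrow> ('a \<Rightarrow> 'b \<Rightarrow> real) \<Rightarrow> ereal" where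
  "lower_value S T u = (SUP x\<in>S. INF y\<in>T. ereal (u x y))"

definition upper_value :: "'a set \<Rightarrow> 'b set \<Rightarrow> ('a \<Rightarrow> 'b \<Rightarrow> real) \<Rightarrow> ereal" where
  "upper_value S T u = (INF y\<in>T. SUP x\<in>S. ereal (u x y))"

definition is_max_on :: "('a \<Rightarrow> real) \<Rightarrow> 'a set \<Rightarrow> real \<Rightarrow> bool" where
  "is_max_on f S v \<longleftrightarrow> (\<exists>x\<in>S. f x = v) \<and> (\<forall>x\<in>S. f x \<le> v)"

definition is_min_on :: "('a \<Rightarrow> real) \<Rightarrow> 'a set \<Rightarrow> real \<Rightarrow> bool" where
  "is_min_on f S v \<longleftrightarrow> (\<exists>x\<in>S. f x = v) \<and> (\<forall>x\<in>S. v \<le> f x)"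

text \<open>
  Max-min equals min-max, where all maxima and minima (the inner ones for every value of the outer
  variable) are attained.
\<close>

definition minimax_equality :: "'a set \<Rightarrow> 'b set \<Rightarrow> ('a \<Rightarrow> 'b \<Rightarrow> real) \<Rightarrow> bool" where
  "minimax_equality S T u \<longleftrightarrow>
     (\<exists>m M v. (\<forall>x\<in>S. is_min_on (\<lambda>y. u x y) T (m x)) \<and> is_max_on m S v \<and>
              (\<forall>y\<in>T. is_max_on (\<lambda>x. u x y) S (M y)) \<and> is_min_on M T v)"

end

theory Submission
  imports Defs
begin

text \<open>
  Both sides of the equivalence hold outright. An interior point \<open>\<alpha>\<close> of \<open>C\<^sup>*\<close> dominates a multiple
  of the norm on \<open>C\<close>, so the bases \<open>S\<close> and \<open>T\<close> are non-empty, closed, convex and bounded. The payoff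
  is bilinear and, because of the adjoint, continuous in each variable separately, so in reflexive
  spaces the minimax theorem applies and all extrema are attained.

  The proof of the minimax theorem uses no weak topology. By the Mazur-Orlicz theorem
  (\<open>mazur_orlicz\<close>), the support functional \<open>w \<mapsto> sup\<^sub>S w\<close> of \<open>S\<close> on \<open>X\<^sup>*\<close> dominates a linear
  functional \<open>\<phi>\<close> which is at least \<open>v\<close> on a given convex set \<open>W \<subseteq> X\<^sup>*\<close> on which the support
  functional is at least \<open>v\<close>. Reflexivity turns \<open>\<phi>\<close> into evaluation at a point, and separation, which
  is another instance of Mazur-Orlicz, puts this point into \<open>S\<close> (\<open>reflexive_common_maximizer\<close>).
  Taking for \<open>W\<close> a singleton gives the attained inner extrema, and taking \<open>{A\<^sup>*y | y \<in> T}\<close> or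
  \<open>{-Ax | x \<in> S}\<close> gives the optimal strategies.

  For the alternatives in (ii), let \<open>v\<close> be the value of the game for any fixed \<open>\<alpha>\<close> and \<open>\<beta>\<close>. An optimal
  strategy of player I satisfies \<open>Ax - v\<beta> \<in> K\<^sup>*\<close> and one of player II satisfies
  \<open>v\<alpha> - A\<^sup>*y \<in> C\<^sup>*\<close>; the sign of \<open>v\<close> then decides which of the four systems are solvable.
\<close>

section \<open>Sublinear functionals and the Mazur-Orlicz theorem\<close>

text \<open>
  Real-valued sublinear functionals. Homogeneity is only required as an inequality; equality
  follows, and \<open>c = 0\<close> yields \<open>p 0 = 0\<close>.
\<close>

definition sublinear :: "('v::real_vector \<Rightarrow> real) \<Rightarrow> bool" where
  "sublinear p \<longleftrightarrow> (\<forall>x y. p (x + y) \<le> p x + p y) \<and> (\<forall>c x. 0 \<le> c \<longrightarrow> p (c *\<^sub>R x) \<le> c * p x)"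

lemma sublinear_add: "sublinear p \<Longrightarrow> p (x + y) \<le> p x + p y"
  and sublinear_scale_le: "sublinear p \<Longrightarrow> 0 \<le> c \<Longrightarrow> p (c *\<^sub>R x) \<le> c * p x"
  unfolding sublinear_def by blast+

lemma sublinear_zero:
  assumes "sublinear p"
  shows "p 0 = 0"
  using sublinear_add[OF assms, of 0 0] sublinear_scale_le[OF assms, of 0 0] by simp

lemma sublinear_minus: "sublinear p \<Longrightarrow> - p (- x) \<le> p x"
  using sublinear_add[of p x "- x"] sublinear_zero[of p] by simp

lemma sublinear_scale:
  assumes "sublinear p" and "0 \<le> c"
  shows "p (c *\<^sub>R x) = c * p x"
proof (cases "c = 0")
  case True
  then show ?thesis using sublinear_zero[OF assms(1)] by simp
next
  case False
  with assms have "c > 0" by simp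
  have "p ((1 / c) *\<^sub>R (c *\<^sub>R x)) \<le> (1 / c) * p (c *\<^sub>R x)"
    by (rule sublinear_scale_le[OF assms(1)]) (use \<open>c > 0\<close> in simp)
  then have "c * p x \<le> p (c *\<^sub>R x)"
    using \<open>c > 0\<close> by (simp add: field_simps)
  then show ?thesis using sublinear_scale_le[OF assms, of x] by simp
qed

text \<open>
  If \<open>p \<ge> b\<close> on a convex set \<open>W\<close>, then \<open>p\<close> can be lowered to a sublinear functional every linear
  minorant of which is at least \<open>b\<close> on \<open>W\<close>, namely to
  \<open>q x = inf {p (x + t w) - t b | t \<ge> 0, w \<in> W}\<close>.
\<close>

lemma sublinear_lower_on_convex:
  assumes p: "sublinear p" and W: "convex W" "W \<noteq> {}" and b: "\<And>w. w \<in> W \<Longrightarrow> b \<le> p w"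
  shows "\<exists>q. sublinear q \<and> (\<forall>x. q x \<le> p x) \<and> (\<forall>w\<in>W. q (- w) \<le> - b)"
proof -
  define g where "g x z = p (x + fst z *\<^sub>R snd z) - fst z * b" for x and z :: "real \<times> 'a"
  define q where "q x = (INF z\<in>{0..}\<times>W. g x z)" for x
  obtain w0 where w0: "w0 \<in> W" using W by blast
  have ne: "{0::real..} \<times> W \<noteq> {}" using W by auto
  have lower: "- p (- x) \<le> g x z" if mem: "z \<in> {0..} \<times> W" for x z
  proof -
    obtain t w where z: "z = (t, w)" "0 \<le> t" "w \<in> W" using mem by (cases z) auto
    have "t * b \<le> t * p w" using z b mult_left_mono by blast
    also have "\<dots> = p (t *\<^sub>R w)" using sublinear_scale[OF p] z by simp
    also have "\<dots> \<le> p (x + t *\<^sub>R w) + p (- x)"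
      using sublinear_add[OF p, of "x + t *\<^sub>R w" "- x"] by simp
    finally show ?thesis by (simp add: g_def z)
  qed
  have bdd: "bdd_below (g x ` ({0..} \<times> W))" for x
    using lower by (intro bdd_belowI[of _ "- p (- x)"]) blast
  have q_le: "q x \<le> p (x + t *\<^sub>R w) - t * b" if "0 \<le> t" "w \<in> W" for x t w
    using cINF_lower[OF bdd, of "(t, w)" x] that by (simp add: q_def g_def)
  have q_ge: "l \<le> q x" if "\<And>t w. 0 \<le> t \<Longrightarrow> w \<in> W \<Longrightarrow> l \<le> p (x + t *\<^sub>R w) - t * b" for l x
    unfolding q_def by (rule cINF_greatest[OF ne]) (use that in \<open>auto simp: g_def\<close>)
  have "q (x + y) \<le> q x + q y" for x y
  proof -
    have step: "q (x + y) \<le> (p (x + s *\<^sub>R w) - s * b) + (p (y + t *\<^sub>R w') - t * b)"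
      if st: "0 \<le> s" "w \<in> W" "0 \<le> t" "w' \<in> W" for s w t w'
    proof -
      \<comment> \<open>Convexity merges the two directions into one, \<open>w0\<close> serving the case \<open>s = t = 0\<close>.\<close>
      obtain w'' where w'': "w'' \<in> W" "s *\<^sub>R w + t *\<^sub>R w' = (s + t) *\<^sub>R w''"
      proof (cases "s + t = 0")
        case True
        with st have "s = 0" "t = 0" by auto
        then show ?thesis using that w0 by simp
      next
        case False
        let ?c = "(s / (s + t)) *\<^sub>R w + (t / (s + t)) *\<^sub>R w'"
        have "?c \<in> W"
          using convexD[OF W(1) st(2) st(4), of "s / (s + t)" "t / (s + t)"] st False
          by (simp add: add_divide_distrib[symmetric])
        moreover have "s *\<^sub>R w + t *\<^sub>R w' = (s + t) *\<^sub>R ?c"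
          using False by (simp add: scaleR_add_right)
        ultimately show ?thesis using that by blast
      qed
      have "q (x + y) \<le> p (x + y + (s + t) *\<^sub>R w'') - (s + t) * b"
        using q_le st w'' by simp
      also have "x + y + (s + t) *\<^sub>R w'' = (x + s *\<^sub>R w) + (y + t *\<^sub>R w')"
        using w''(2) by (simp add: algebra_simps)
      also have "p \<dots> \<le> p (x + s *\<^sub>R w) + p (y + t *\<^sub>R w')" by (rule sublinear_add[OF p])
      finally show ?thesis by (simp add: algebra_simps)
    qed
    have "q (x + y) - (p (x + s *\<^sub>R w) - s * b) \<le> q y" if "0 \<le> s" "w \<in> W" for s w
      by (rule q_ge) (use step[OF that] in \<open>simp add: algebra_simps\<close>)
    then have "q (x + y) - q y \<le> q x"
      by (intro q_ge) (simp add: algebra_simps)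
    then show ?thesis by simp
  qed
  moreover have "q (c *\<^sub>R x) \<le> c * q x" if c: "0 \<le> c" for c x
  proof (cases "c = 0")
    case True
    then show ?thesis using q_le[OF order_refl w0, of 0] sublinear_zero[OF p] by simp
  next
    case False
    with c have "c > 0" by simp
    have "q (c *\<^sub>R x) / c \<le> p (x + t *\<^sub>R w) - t * b" if tw: "0 \<le> t" "w \<in> W" for t w
    proof -
      have "q (c *\<^sub>R x) \<le> p (c *\<^sub>R x + (c * t) *\<^sub>R w) - c * t * b"
        using q_le tw c by simp
      also have "c *\<^sub>R x + (c * t) *\<^sub>R w = c *\<^sub>R (x + t *\<^sub>R w)" by (simp add: scaleR_add_right)
      also have "p \<dots> = c * p (x + t *\<^sub>R w)" by (rule sublinear_scale[OF p c])
      finally show ?thesis using \<open>c > 0\<close> by (simp add: field_simps)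
    qed
    then have "q (c *\<^sub>R x) / c \<le> q x" by (rule q_ge)
    then show ?thesis using \<open>c > 0\<close> by (simp add: field_simps)
  qed
  ultimately have "sublinear q" unfolding sublinear_def by blast
  moreover have "q x \<le> p x" for x using q_le[OF order_refl w0, of x] by simp
  moreover have "q (- w) \<le> - b" if "w \<in> W" for w
    using q_le[of 1 w "- w"] that sublinear_zero[OF p] by simp
  ultimately show ?thesis by blast
qed

lemma minimal_sublinear_imp_linear:
  assumes p: "sublinear p"
    and minimal: "\<And>q. sublinear q \<Longrightarrow> (\<And>x. q x \<le> p x) \<Longrightarrow> q = p"
  shows "linear p"
proof -
  have neg: "p (- v) = - p v" for v
  proof -
    \<comment> \<open>Lowering \<open>p\<close> along the singleton \<open>{v}\<close> cannot change it, by minimality.\<close>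
    obtain q where "sublinear q" "\<And>x. q x \<le> p x" "q (- v) \<le> - p v"
      using sublinear_lower_on_convex[OF p, of "{v}" "p v"] by auto
    then have "p (- v) \<le> - p v" using minimal by blast
    then show ?thesis using sublinear_minus[OF p, of v] by simp
  qed
  show ?thesis
  proof (rule linearI)
    fix x y
    have "- p (x + y) \<le> - p x + - p y"
      using sublinear_add[OF p, of "- x" "- y"] neg[of "x + y"] neg[of x] neg[of y] by simp
    then show "p (x + y) = p x + p y" using sublinear_add[OF p, of x y] by simp
  next
    fix c x
    show "p (c *\<^sub>R x) = c *\<^sub>R p x"
    proof (cases "0 \<le> c")
      case True
      then show ?thesis using sublinear_scale[OF p] by simp
    next
      case False
      then show ?thesis
        using sublinear_scale[OF p, of "- c" x] neg[of "c *\<^sub>R x"] by simp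
    qed
  qed
qed

text \<open>The Hahn-Banach theorem, by Zorn's lemma on the sublinear functionals below \<open>p\<close>.\<close>

lemma sublinear_has_linear_minorant:
  assumes p: "sublinear p"
  shows "\<exists>f. linear f \<and> (\<forall>x. f x \<le> p x)"
proof -
  define Q where "Q = {q. sublinear q \<and> q \<le> p}"
  let ?r = "relation_of (\<lambda>f g. g \<le> f) Q"
  have "\<exists>m\<in>Q. \<forall>a\<in>Q. a \<le> m \<longrightarrow> a = m"
  proof (rule predicate_Zorn)
    show "partial_order_on Q ?r"
      by (rule partial_order_on_relation_ofI) auto
  next
    fix H assume H: "H \<in> Chains ?r"
    then have HQ: "H \<subseteq> Q" unfolding Chains_def relation_of_def by blast
    have tot: "f \<le> g \<or> g \<le> f" if "f \<in> H" "g \<in> H" for f g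
      using H that unfolding Chains_def relation_of_def by blast
    show "\<exists>u\<in>Q. \<forall>a\<in>H. u \<le> a"
    proof (cases "H = {}")
      case True
      then show ?thesis using p unfolding Q_def by blast
    next
      case False
      define q where "q x = (INF f\<in>H. f x)" for x
      have "- p (- x) \<le> f x" if "f \<in> H" for f x
      proof -
        have "sublinear f" "f (- x) \<le> p (- x)" using that HQ unfolding Q_def le_fun_def by auto
        then show ?thesis using sublinear_minus[of f x] by simp
      qed
      then have bdd: "bdd_below ((\<lambda>f. f x) ` H)" for x
        by (intro bdd_belowI[of _ "- p (- x)"]) blast
      have q_le: "q x \<le> f x" if "f \<in> H" for f x
        unfolding q_def using cINF_lower[OF bdd that] .
      have q_ge: "l \<le> q x" if "\<And>f. f \<in> H \<Longrightarrow> l \<le> f x" for l x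
        unfolding q_def using that by (rule cINF_greatest[OF False])
      have sub: "sublinear f" if "f \<in> H" for f using HQ that unfolding Q_def by blast
      have "q (x + y) \<le> q x + q y" for x y
      proof -
        have sum_le: "q (x + y) \<le> f x + g y" if fg: "f \<in> H" "g \<in> H" for f g
        proof -
          \<comment> \<open>The smaller of the two chain members serves both summands.\<close>
          obtain h where h: "h \<in> H" "h \<le> f" "h \<le> g" using tot fg by blast
          have "q (x + y) \<le> h (x + y)" by (rule q_le[OF h(1)])
          also have "\<dots> \<le> h x + h y" by (rule sublinear_add[OF sub[OF h(1)]])
          also have "\<dots> \<le> f x + g y" using h by (simp add: add_mono le_fun_def)
          finally show ?thesis .
        qed
        have "q (x + y) - f x \<le> q y" if "f \<in> H" for f
          by (rule q_ge) (use sum_le[OF that] in \<open>simp add: diff_le_eq add.commute[of _ "f x"]\<close>)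
        then have "q (x + y) - q y \<le> q x"
          by (intro q_ge) (simp add: diff_le_eq add.commute[of _ "q y"])
        then show ?thesis by simp
      qed
      moreover have "q (c *\<^sub>R x) \<le> c * q x" if c: "0 \<le> c" for c x
      proof (cases "c = 0")
        case True
        obtain f where "f \<in> H" using False by blast
        then show ?thesis using True q_le[of f 0] sublinear_zero[OF sub, of f] by simp
      next
        case False
        with c have "c > 0" by simp
        have "q (c *\<^sub>R x) / c \<le> f x" if f: "f \<in> H" for f
          using q_le[OF f, of "c *\<^sub>R x"] sublinear_scale[OF sub[OF f] c, of x] \<open>c > 0\<close>
          by (simp add: field_simps)
        then have "q (c *\<^sub>R x) / c \<le> q x" by (rule q_ge)
        then show ?thesis using \<open>c > 0\<close> by (simp add: field_simps)
      qed
      ultimately have "sublinear q" unfolding sublinear_def by blast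
      moreover have "q \<le> p"
      proof -
        obtain f where "f \<in> H" using False by blast
        then have "f \<le> p" using HQ unfolding Q_def by blast
        then show ?thesis using q_le[OF \<open>f \<in> H\<close>] by (meson le_funI le_funD order_trans)
      qed
      ultimately have "q \<in> Q" unfolding Q_def by blast
      then show ?thesis using q_le by (blast intro: le_funI)
    qed
  qed
  then obtain m where m: "sublinear m" "m \<le> p" and min: "\<And>a. a \<in> Q \<Longrightarrow> a \<le> m \<Longrightarrow> a = m"
    unfolding Q_def by blast
  have "linear m"
  proof (rule minimal_sublinear_imp_linear[OF m(1)])
    fix q assume "sublinear q" and "\<And>x. q x \<le> m x"
    then have "q \<le> m" by (simp add: le_funI)
    with \<open>sublinear q\<close> m have "q \<in> Q" unfolding Q_def by auto
    then show "q = m" using min \<open>q \<le> m\<close> by blast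
  qed
  then show ?thesis using m(2) by (blast dest: le_funD)
qed

theorem mazur_orlicz:
  assumes "sublinear p" and "convex W" and "W \<noteq> {}" and "\<And>w. w \<in> W \<Longrightarrow> b \<le> p w"
  shows "\<exists>f. linear f \<and> (\<forall>x. f x \<le> p x) \<and> (\<forall>w\<in>W. b \<le> f w)"
proof -
  obtain q where q: "sublinear q" "\<And>x. q x \<le> p x" "\<And>w. w \<in> W \<Longrightarrow> q (- w) \<le> - b"
    using sublinear_lower_on_convex[OF assms] by blast
  obtain f where f: "linear f" "\<And>x. f x \<le> q x"
    using sublinear_has_linear_minorant[OF q(1)] by blast
  have "b \<le> f w" if "w \<in> W" for w
    using f(2)[of "- w"] q(3)[OF that] linear_neg[OF f(1), of w] by simp
  then show ?thesis using f q(2) order_trans by blast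
qed

section \<open>Separation and attained suprema in reflexive spaces\<close>

lemma mazur_orlicz_bounded:
  fixes p :: "'v::real_normed_vector \<Rightarrow> real"
  assumes "sublinear p" and "convex W" and "W \<noteq> {}" and "\<And>w. w \<in> W \<Longrightarrow> b \<le> p w"
    and B: "\<And>x. p x \<le> norm x * B"
  shows "\<exists>f :: 'v dual. (\<forall>x. blinfun_apply f x \<le> p x) \<and> (\<forall>w\<in>W. b \<le> blinfun_apply f w)"
proof -
  obtain f where f: "linear f" "\<And>x. f x \<le> p x" "\<And>w. w \<in> W \<Longrightarrow> b \<le> f w"
    using mazur_orlicz[OF assms(1-4)] by blast
  have "norm (f x) \<le> norm x * B" for x
    using order_trans[OF f(2) B, of x] order_trans[OF f(2) B, of "- x"] linear_neg[OF f(1), of x]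
    by (simp add: abs_le_iff)
  then have "bounded_linear f"
    using f(1) by (intro bounded_linear_intro[of f B]) (auto simp: linear_add linear_scale)
  then show ?thesis using f by (intro exI[of _ "Blinfun f"]) (simp add: bounded_linear_Blinfun_apply)
qed

lemma sublinear_norm: "sublinear (norm :: 'v::real_normed_vector \<Rightarrow> real)"
  unfolding sublinear_def by (simp add: norm_triangle_ineq)

lemma exists_norming_functional:
  fixes x :: "'v::real_normed_vector"
  shows "\<exists>f :: 'v dual. norm f \<le> 1 \<and> norm x \<le> blinfun_apply f x"
proof -
  obtain f :: "'v dual" where f: "\<And>z. blinfun_apply f z \<le> norm z" "norm x \<le> blinfun_apply f x"
    using mazur_orlicz_bounded[OF sublinear_norm, of "{x}" "norm x" 1] by auto
  have "norm (blinfun_apply f z) \<le> 1 * norm z" for z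
    using f(1)[of z] f(1)[of "- z"] by (simp add: blinfun.minus_right abs_le_iff)
  then have "norm f \<le> 1" by (intro norm_blinfun_bound) auto
  with f(2) show ?thesis by blast
qed

lemma separate_point_closed_convex:
  fixes S :: "'v::real_normed_vector set"
  assumes S: "convex S" "closed S" "S \<noteq> {}" and z: "z \<notin> S"
  shows "\<exists>(f :: 'v dual) d. 0 < d \<and> (\<forall>s\<in>S. blinfun_apply f s + d \<le> blinfun_apply f z)"
proof -
  obtain d where "0 < d" "ball z d \<subseteq> - S"
    using S(2) z openE[of "- S" z] by (auto simp: open_Compl)
  then have d: "0 < d" "\<And>s. s \<in> S \<Longrightarrow> d \<le> dist z s" by (auto simp: not_less[symmetric])
  let ?W = "(\<lambda>s. - z + s) ` S"
  have "convex ?W" using S(1) by (rule convex_translation)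
  moreover have "d \<le> norm w" if "w \<in> ?W" for w
    using that d(2) by (auto simp: dist_norm norm_minus_commute)
  ultimately obtain f :: "'v dual" where f: "\<And>w. w \<in> ?W \<Longrightarrow> d \<le> blinfun_apply f w"
    using mazur_orlicz_bounded[OF sublinear_norm, of ?W d 1] S(3) by auto
  have "blinfun_apply (- f) s + d \<le> blinfun_apply (- f) z" if "s \<in> S" for s
    using f[of "- z + s"] that by (simp add: blinfun.bilinear_simps)
  with d(1) show ?thesis by blast
qed

lemma bdd_above_functional:
  fixes S :: "'v::real_normed_vector set" and w :: "'v dual"
  assumes "bounded S"
  shows "bdd_above (blinfun_apply w ` S)"
  using assms by (intro bounded_imp_bdd_above bounded_linear_image) (auto simp: blinfun.bounded_linear_right)

text \<open>
  This lemma replaces weak compactness: by duality, a point of \<open>S\<close> that makes all functionals in \<open>W\<close>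
  large at once exists as soon as each of them alone has a large supremum over \<open>S\<close>.
\<close>

lemma reflexive_common_maximizer:
  fixes S :: "'v::real_normed_vector set" and W :: "'v dual set"
  assumes refl: "reflexive_space TYPE('v)"
    and S: "convex S" "closed S" "bounded S" "S \<noteq> {}"
    and W: "convex W" "W \<noteq> {}" and v: "\<And>w. w \<in> W \<Longrightarrow> v \<le> (SUP x\<in>S. blinfun_apply w x)"
  shows "\<exists>x\<in>S. \<forall>w\<in>W. v \<le> blinfun_apply w x"
proof -
  define p where "p w = (SUP x\<in>S. blinfun_apply w x)" for w :: "'v dual"
  have p_ge: "blinfun_apply w x \<le> p w" if "x \<in> S" for w x
    unfolding p_def by (rule cSUP_upper[OF that bdd_above_functional[OF S(3)]])
  have p_le: "p w \<le> l" if "\<And>x. x \<in> S \<Longrightarrow> blinfun_apply w x \<le> l" for w l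
    unfolding p_def using that by (rule cSUP_least[OF S(4)])
  obtain B where B: "\<And>x. x \<in> S \<Longrightarrow> norm x \<le> B" using S(3) bounded_iff by blast
  have sub: "sublinear p" unfolding sublinear_def
  proof safe
    fix w w' :: "'v dual"
    show "p (w + w') \<le> p w + p w'"
      by (rule p_le) (simp add: blinfun.add_left add_mono p_ge)
  next
    fix c :: real and w :: "'v dual" assume "0 \<le> c"
    then show "p (c *\<^sub>R w) \<le> c * p w"
      by (intro p_le) (simp add: blinfun.scaleR_left mult_left_mono p_ge)
  qed
  have pB: "p w \<le> norm w * B" for w
  proof (rule p_le)
    fix x assume "x \<in> S"
    have "blinfun_apply w x \<le> norm (blinfun_apply w x)" by simp
    also have "\<dots> \<le> norm w * norm x" by (rule norm_blinfun)
    also have "\<dots> \<le> norm w * B" using B[OF \<open>x \<in> S\<close>] by (intro mult_left_mono) auto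
    finally show "blinfun_apply w x \<le> norm w * B" .
  qed
  obtain \<phi> :: "'v dual dual"
    where \<phi>: "\<And>w. blinfun_apply \<phi> w \<le> p w" "\<And>w. w \<in> W \<Longrightarrow> v \<le> blinfun_apply \<phi> w"
    using mazur_orlicz_bounded[OF sub W, of v B] v pB unfolding p_def by blast
  obtain x where x: "\<And>w. blinfun_apply \<phi> w = blinfun_apply w x"
    using refl unfolding reflexive_space_def by blast
  have "x \<in> S"
  proof (rule ccontr)
    assume "x \<notin> S"
    then obtain f :: "'v dual" and d
      where d: "0 < d" and f: "\<And>s. s \<in> S \<Longrightarrow> blinfun_apply f s + d \<le> blinfun_apply f x"
      using separate_point_closed_convex[OF S(1,2,4)] by blast
    have "p f \<le> blinfun_apply f x - d" by (rule p_le) (use f in \<open>simp add: le_diff_eq\<close>)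
    then show False using \<phi>(1)[of f] x[of f] d by simp
  qed
  then show ?thesis using \<phi>(2) x by auto
qed

lemma reflexive_maximizer:
  fixes S :: "'v::real_normed_vector set" and w :: "'v dual"
  assumes "reflexive_space TYPE('v)" and "convex S" "closed S" "bounded S" "S \<noteq> {}"
  shows "\<exists>x\<in>S. \<forall>x'\<in>S. blinfun_apply w x' \<le> blinfun_apply w x"
proof -
  have "\<exists>x\<in>S. \<forall>w'\<in>{w}. (SUP x\<in>S. blinfun_apply w x) \<le> blinfun_apply w' x"
    by (rule reflexive_common_maximizer[OF assms]) auto
  then obtain x where x: "x \<in> S" "(SUP x\<in>S. blinfun_apply w x) \<le> blinfun_apply w x" by blast
  have "blinfun_apply w x' \<le> blinfun_apply w x" if "x' \<in> S" for x'
    using cSUP_upper[OF that bdd_above_functional[OF assms(4)]] x(2) by (rule order_trans)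
  with x(1) show ?thesis by blast
qed

section \<open>The bilinear minimax theorem in reflexive spaces\<close>

lemma reflexive_bilinear_minimax:
  fixes S :: "'a::real_normed_vector set" and T :: "'b::real_normed_vector set"
    and A :: "'a \<Rightarrow> 'b dual"
  assumes reflX: "reflexive_space TYPE('a)" and reflY: "reflexive_space TYPE('b)"
    and S: "convex S" "closed S" "bounded S" "S \<noteq> {}"
    and T: "convex T" "closed T" "bounded T" "T \<noteq> {}"
    and A: "operator_with_adjoint A"
  shows "minimax_equality S T (payoff A)"
proof -
  let ?u = "payoff A"
  have adj: "blinfun_apply (dual_adjoint A y) x = ?u x y" for x y
    using dual_adjoint_apply[OF A] by (simp add: payoff_def)
  have linA: "linear A" using A unfolding operator_with_adjoint_def by blast
  have "\<exists>x\<in>S. \<forall>x'\<in>S. ?u x' y \<le> ?u x y" for y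
    using reflexive_maximizer[OF reflX S, of "dual_adjoint A y"] by (simp add: adj)
  then obtain bestx where bestx: "\<And>y. bestx y \<in> S" "\<And>x y. x \<in> S \<Longrightarrow> ?u x y \<le> ?u (bestx y) y"
    by metis
  have "\<exists>y\<in>T. \<forall>y'\<in>T. ?u x y \<le> ?u x y'" for x
    using reflexive_maximizer[OF reflY T, of "- A x"] by (simp add: blinfun.minus_left payoff_def)
  then obtain besty where besty: "\<And>x. besty x \<in> T" "\<And>x y. y \<in> T \<Longrightarrow> ?u x (besty x) \<le> ?u x y"
    by metis
  define M where "M y = ?u (bestx y) y" for y
  define m where "m x = ?u x (besty x)" for x
  have mM: "m x \<le> M y" if "x \<in> S" "y \<in> T" for x y
    using order_trans[OF besty(2) bestx(2)] that unfolding m_def M_def by blast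
  define v where "v = (INF y\<in>T. M y)"
  obtain x1 where x1: "x1 \<in> S" using S by blast
  have "bdd_below (M ` T)" using mM[OF x1] by (intro bdd_belowI[of _ "m x1"]) blast
  then have v_le: "v \<le> M y" if "y \<in> T" for y unfolding v_def using that by (rule cINF_lower)
  have m_le: "m x \<le> v" if "x \<in> S" for x
    unfolding v_def using mM[OF that] by (rule cINF_greatest[OF T(4)])
  have "\<exists>x\<in>S. \<forall>w\<in>dual_adjoint A ` T. v \<le> blinfun_apply w x"
  proof (rule reflexive_common_maximizer[OF reflX S])
    have "linear (dual_adjoint A)"
      by (rule linearI; rule blinfun_eqI)
        (simp_all add: dual_adjoint_apply[OF A] blinfun.bilinear_simps)
    then show "convex (dual_adjoint A ` T)" using T(1) by (rule convex_linear_image)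
    show "dual_adjoint A ` T \<noteq> {}" using T(4) by simp
    fix w assume "w \<in> dual_adjoint A ` T"
    then obtain y where y: "y \<in> T" "w = dual_adjoint A y" by blast
    show "v \<le> (SUP x\<in>S. blinfun_apply w x)"
      by (rule cSUP_upper2[OF bdd_above_functional[OF S(3)] bestx(1)[of y]])
        (use v_le[OF y(1)] in \<open>simp add: y(2) adj M_def\<close>)
  qed
  then obtain x0 where x0: "x0 \<in> S" "\<And>y. y \<in> T \<Longrightarrow> v \<le> ?u x0 y" by (auto simp: adj)
  have "\<exists>y\<in>T. \<forall>w\<in>(\<lambda>x. - A x) ` S. - v \<le> blinfun_apply w y"
  proof (rule reflexive_common_maximizer[OF reflY T])
    show "convex ((\<lambda>x. - A x) ` S)"
      using S(1) by (intro convex_linear_image linear_compose_neg linA)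
    show "(\<lambda>x. - A x) ` S \<noteq> {}" using S(4) by simp
    fix w assume "w \<in> (\<lambda>x. - A x) ` S"
    then obtain x where x: "x \<in> S" "w = - A x" by blast
    show "- v \<le> (SUP y\<in>T. blinfun_apply w y)"
      by (rule cSUP_upper2[OF bdd_above_functional[OF T(3)] besty(1)[of x]])
        (use m_le[OF x(1)] in \<open>simp add: x(2) m_def payoff_def blinfun.minus_left\<close>)
  qed
  then obtain y0 where y0: "y0 \<in> T" "\<And>x. x \<in> S \<Longrightarrow> ?u x y0 \<le> v"
    by (auto simp: payoff_def blinfun.minus_left)
  have "m x0 = v" using m_le[OF x0(1)] x0(2)[OF besty(1)] unfolding m_def by (simp add: antisym)
  moreover have "M y0 = v" using v_le[OF y0(1)] y0(2)[OF bestx(1)] unfolding M_def by (simp add: antisym)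
  ultimately have "is_max_on m S v" "is_min_on M T v"
    unfolding is_max_on_def is_min_on_def using x0(1) y0(1) m_le v_le by blast+
  moreover have "is_min_on (?u x) T (m x)" for x
    unfolding is_min_on_def m_def using besty by blast
  moreover have "is_max_on (\<lambda>x. ?u x y) S (M y)" for y
    unfolding is_max_on_def M_def using bestx by blast
  ultimately show ?thesis unfolding minimax_equality_def by blast
qed

lemma minimax_equality_optimal_strategies:
  assumes "minimax_equality S T u"
  obtains v x y where "x \<in> S" "\<And>y'. y' \<in> T \<Longrightarrow> v \<le> u x y'" "y \<in> T" "\<And>x'. x' \<in> S \<Longrightarrow> u x' y \<le> v"
  using assms unfolding minimax_equality_def is_max_on_def is_min_on_def by metis

section \<open>Bases of cones\<close>

lemma interior_dual_cone_dominates_norm: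
  fixes C :: "'v::real_normed_vector set"
  assumes "\<alpha> \<in> interior (dual_cone C)"
  obtains e where "0 < e" "\<And>x. x \<in> C \<Longrightarrow> e * norm x \<le> blinfun_apply \<alpha> x"
proof -
  obtain e where e: "0 < e" "cball \<alpha> e \<subseteq> dual_cone C" using assms mem_interior_cball by blast
  have "e * norm x \<le> blinfun_apply \<alpha> x" if "x \<in> C" for x
  proof -
    obtain f :: "'v dual" where f: "norm f \<le> 1" "norm x \<le> blinfun_apply f x"
      using exists_norming_functional by blast
    \<comment> \<open>Moving from \<open>\<alpha>\<close> against a norming functional of \<open>x\<close> by \<open>e\<close> stays in the dual cone.\<close>
    have "\<alpha> - e *\<^sub>R f \<in> cball \<alpha> e" using e(1) f(1) by (simp add: dist_norm)
    then have "0 \<le> blinfun_apply (\<alpha> - e *\<^sub>R f) x" using e(2) that unfolding dual_cone_def by blast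
    then have "e * blinfun_apply f x \<le> blinfun_apply \<alpha> x" by (simp add: blinfun.bilinear_simps)
    moreover have "e * norm x \<le> e * blinfun_apply f x" using f(2) e(1) by simp
    ultimately show ?thesis by simp
  qed
  with e(1) show ?thesis using that by blast
qed

lemma interior_dual_cone_pos:
  fixes C :: "'v::real_normed_vector set"
  assumes "\<alpha> \<in> interior (dual_cone C)" and "x \<in> C - {0}"
  shows "0 < blinfun_apply \<alpha> x"
proof -
  obtain e where "0 < e" "e * norm x \<le> blinfun_apply \<alpha> x"
    using interior_dual_cone_dominates_norm[OF assms(1)] assms(2) by blast
  moreover from \<open>0 < e\<close> have "0 < e * norm x" using assms(2) by simp
  ultimately show ?thesis by linarith
qed

lemma strategies_props:
  fixes C :: "'v::real_normed_vector set"
  assumes C: "convex_cone C" "closed C" "C \<noteq> {0}" and \<alpha>: "\<alpha> \<in> interior (dual_cone C)"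
  shows convex_strategies: "convex (strategies C \<alpha>)" and closed_strategies: "closed (strategies C \<alpha>)"
    and bounded_strategies: "bounded (strategies C \<alpha>)"
    and strategies_nonempty: "strategies C \<alpha> \<noteq> {}"
proof -
  have eq: "strategies C \<alpha> = C \<inter> blinfun_apply \<alpha> -` {1}" unfolding strategies_def by auto
  show "convex (strategies C \<alpha>)" unfolding eq
    using C(1) by (intro convex_Int convex_linear_vimage)
      (auto simp: convex_cone_def blinfun.bounded_linear_right bounded_linear.linear)
  show "closed (strategies C \<alpha>)" unfolding eq
    using C(2) by (intro closed_Int closed_vimage) (auto intro: continuous_intros)
  obtain e where e: "0 < e" "\<And>x. x \<in> C \<Longrightarrow> e * norm x \<le> blinfun_apply \<alpha> x"
    using interior_dual_cone_dominates_norm[OF \<alpha>] by blast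
  have "norm x \<le> 1 / e" if "x \<in> strategies C \<alpha>" for x
    using that e(1) e(2)[of x] unfolding strategies_def by (simp add: field_simps)
  then show "bounded (strategies C \<alpha>)" unfolding bounded_iff by blast
  obtain x where x: "x \<in> C - {0}" using C by (auto simp: convex_cone_def)
  have pos: "0 < blinfun_apply \<alpha> x" by (rule interior_dual_cone_pos[OF \<alpha> x])
  have "(1 / blinfun_apply \<alpha> x) *\<^sub>R x \<in> C"
    using x pos C(1) by (auto simp: convex_cone_def conic_def)
  then have "(1 / blinfun_apply \<alpha> x) *\<^sub>R x \<in> strategies C \<alpha>"
    using pos unfolding strategies_def by (simp add: blinfun.scaleR_right)
  then show "strategies C \<alpha> \<noteq> {}" by blast
qed

text \<open>An inequality on the base of a cone extends to the whole cone by homogeneity.\<close>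

lemma dual_cone_if_ge_on_strategies:
  fixes C :: "'v::real_normed_vector set"
  assumes C: "convex_cone C" and \<alpha>: "\<alpha> \<in> interior (dual_cone C)"
    and ge: "\<And>x. x \<in> strategies C \<alpha> \<Longrightarrow> c \<le> blinfun_apply w x"
  shows "w - c *\<^sub>R \<alpha> \<in> dual_cone C"
  unfolding dual_cone_def
proof safe
  fix x assume x: "x \<in> C"
  show "0 \<le> blinfun_apply (w - c *\<^sub>R \<alpha>) x"
  proof (cases "x = 0")
    case False
    define a where "a = blinfun_apply \<alpha> x"
    have pos: "0 < a" unfolding a_def using interior_dual_cone_pos[OF \<alpha>] x False by blast
    have "(1 / a) *\<^sub>R x \<in> C" using x pos C by (auto simp: convex_cone_def conic_def)
    then have "(1 / a) *\<^sub>R x \<in> strategies C \<alpha>"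
      using pos unfolding strategies_def by (simp add: blinfun.scaleR_right a_def)
    then have "c \<le> (1 / a) * blinfun_apply w x" using ge by (fastforce simp: blinfun.scaleR_right)
    then have "c * a \<le> blinfun_apply w x" using pos by (simp add: field_simps)
    then show ?thesis by (simp add: blinfun.bilinear_simps a_def)
  qed simp
qed

lemma dual_cone_add: "w \<in> dual_cone C \<Longrightarrow> w' \<in> dual_cone C \<Longrightarrow> w + w' \<in> dual_cone C"
  and dual_cone_scale: "0 \<le> c \<Longrightarrow> w \<in> dual_cone C \<Longrightarrow> c *\<^sub>R w \<in> dual_cone C"
  unfolding dual_cone_def by (auto simp: blinfun.bilinear_simps)

lemma dual_cone_if_diff_interior:
  assumes "w - c *\<^sub>R \<alpha> \<in> dual_cone C" and "\<alpha> \<in> interior (dual_cone C)" and "0 \<le> c"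
  shows "w \<in> dual_cone C"
proof -
  have "\<alpha> \<in> dual_cone C" using assms(2) interior_subset by blast
  then show ?thesis using dual_cone_add[OF assms(1) dual_cone_scale[OF assms(3)]] by fastforce
qed

lemma interior_dual_cone_if_diff_interior:
  fixes C :: "'v::real_normed_vector set"
  assumes d: "w - c *\<^sub>R \<alpha> \<in> dual_cone C" and \<alpha>: "\<alpha> \<in> interior (dual_cone C)" and c: "0 < c"
  shows "w \<in> interior (dual_cone C)"
proof (rule interiorI)
  let ?U = "(\<lambda>z. (w - c *\<^sub>R \<alpha>) + c *\<^sub>R z) ` interior (dual_cone C)"
  show "open ?U"
    using open_affinity[OF open_interior, of c "w - c *\<^sub>R \<alpha>"] c by simp
  show "w \<in> ?U" by (rule image_eqI[OF _ \<alpha>]) simp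
  show "?U \<subseteq> dual_cone C"
  proof
    fix u assume "u \<in> ?U"
    then obtain z where "z \<in> dual_cone C" "u = (w - c *\<^sub>R \<alpha>) + c *\<^sub>R z"
      using interior_subset by blast
    then show "u \<in> dual_cone C" using dual_cone_add[OF d dual_cone_scale] c by simp
  qed
qed

section \<open>The theorem of the alternative\<close>

lemma strategies_subset:
  fixes C :: "'v::real_normed_vector set"
  shows "strategies C \<alpha> \<subseteq> C - {0}"
  unfolding strategies_def by auto

lemma alternative_if_minimax:
  fixes C :: "'a::real_normed_vector set" and K :: "'b::real_normed_vector set"
    and A :: "'a \<Rightarrow> 'b dual"
  assumes C: "convex_cone C" and K: "convex_cone K"
    and \<alpha>: "\<alpha> \<in> interior (dual_cone C)" and \<beta>: "\<beta> \<in> interior (dual_cone K)"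
    and A: "operator_with_adjoint A"
    and mm: "minimax_equality (strategies C \<alpha>) (strategies K \<beta>) (payoff A)"
  shows "(\<exists>y \<in> K - {0}. - dual_adjoint A y \<in> dual_cone C)
           \<longleftrightarrow> \<not> (\<exists>x \<in> C - {0}. A x \<in> interior (dual_cone K))" (is "?a \<longleftrightarrow> \<not> ?b")
    and "(\<exists>y \<in> K - {0}. - dual_adjoint A y \<in> interior (dual_cone C))
           \<longleftrightarrow> \<not> (\<exists>x \<in> C - {0}. A x \<in> dual_cone K)" (is "?c \<longleftrightarrow> \<not> ?d")
proof -
  have adj: "blinfun_apply (- dual_adjoint A y) x = - blinfun_apply (A x) y" for x y
    by (simp add: blinfun.minus_left dual_adjoint_apply[OF A])
  obtain v x0 y0 where x0: "x0 \<in> strategies C \<alpha>" "\<And>y. y \<in> strategies K \<beta> \<Longrightarrow> v \<le> payoff A x0 y"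
    and y0: "y0 \<in> strategies K \<beta>" "\<And>x. x \<in> strategies C \<alpha> \<Longrightarrow> payoff A x y0 \<le> v"
    using minimax_equality_optimal_strategies[OF mm] by metis
  have x0C: "x0 \<in> C - {0}" and y0K: "y0 \<in> K - {0}" using x0(1) y0(1) strategies_subset by blast+
  have I: "A x0 - v *\<^sub>R \<beta> \<in> dual_cone K"
    using x0(2) by (intro dual_cone_if_ge_on_strategies[OF K \<beta>]) (simp add: payoff_def)
  have II: "- dual_adjoint A y0 - (- v) *\<^sub>R \<alpha> \<in> dual_cone C"
    using y0(2) by (intro dual_cone_if_ge_on_strategies[OF C \<alpha>]) (simp add: payoff_def adj)
  have b: ?b if "0 < v" using interior_dual_cone_if_diff_interior[OF I \<beta> that] x0C by blast
  have d: ?d if "0 \<le> v" using dual_cone_if_diff_interior[OF I \<beta> that] x0C by blast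
  have c: ?c if "v < 0" using interior_dual_cone_if_diff_interior[OF II \<alpha>] that y0K by auto
  have a: ?a if "v \<le> 0" using dual_cone_if_diff_interior[OF II \<alpha>] that y0K by auto
  have nab: "\<not> (?a \<and> ?b)"
  proof
    assume "?a \<and> ?b"
    then obtain x y where y: "y \<in> K - {0}" "- dual_adjoint A y \<in> dual_cone C"
      and x: "x \<in> C - {0}" "A x \<in> interior (dual_cone K)" by blast
    have "0 \<le> blinfun_apply (- dual_adjoint A y) x" using y x unfolding dual_cone_def by blast
    then show False using interior_dual_cone_pos[OF x(2) y(1)] by (simp add: adj)
  qed
  have ncd: "\<not> (?c \<and> ?d)"
  proof
    assume "?c \<and> ?d"
    then obtain x y where y: "y \<in> K - {0}" "- dual_adjoint A y \<in> interior (dual_cone C)"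
      and x: "x \<in> C - {0}" "A x \<in> dual_cone K" by blast
    have "0 \<le> blinfun_apply (A x) y" using y x unfolding dual_cone_def by blast
    then show False using interior_dual_cone_pos[OF y(2) x(1)] by (simp add: adj)
  qed
  show "?a \<longleftrightarrow> \<not> ?b" using a b nab by (meson linorder_not_le)
  show "?c \<longleftrightarrow> \<not> ?d" using c d ncd by (meson linorder_not_le)
qed

theorem theorem4p4:
  fixes C :: "'a::banach set" and K :: "'b::banach set"
  assumes "reflexive_space TYPE('a)" and "reflexive_space TYPE('b)"
    and "convex_cone C" and "closed C" and "C \<noteq> {0}"
    and "convex_cone K" and "closed K" and "K \<noteq> {0}"
    and "interior (dual_cone C) \<noteq> {}" and "interior (dual_cone K) \<noteq> {}"
  shows
    "(\<forall>\<alpha> \<in> interior (dual_cone C). \<forall>\<beta> \<in> interior (dual_cone K). \<forall>A :: 'a \<Rightarrow> 'b dual.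
        operator_with_adjoint A
        \<and> \<bar>lower_value (strategies C \<alpha>) (strategies K \<beta>) (payoff A)\<bar> \<noteq> \<infinity>
        \<and> \<bar>upper_value (strategies C \<alpha>) (strategies K \<beta>) (payoff A)\<bar> \<noteq> \<infinity>
        \<longrightarrow> minimax_equality (strategies C \<alpha>) (strategies K \<beta>) (payoff A))
     \<longleftrightarrow>
     (\<forall>A :: 'a \<Rightarrow> 'b dual. operator_with_adjoint A \<longrightarrow>
        ((\<exists>y \<in> K - {0}. - dual_adjoint A y \<in> dual_cone C)
           \<longleftrightarrow> \<not> (\<exists>x \<in> C - {0}. A x \<in> interior (dual_cone K)))
        \<and> ((\<exists>y \<in> K - {0}. - dual_adjoint A y \<in> interior (dual_cone C))
           \<longleftrightarrow> \<not> (\<exists>x \<in> C - {0}. A x \<in> dual_cone K)))"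
proof -
  have minimax: "minimax_equality (strategies C \<alpha>) (strategies K \<beta>) (payoff A)"
    if "\<alpha> \<in> interior (dual_cone C)" "\<beta> \<in> interior (dual_cone K)" "operator_with_adjoint A"
    for \<alpha> \<beta> and A :: "'a \<Rightarrow> 'b dual"
    using that assms by (intro reflexive_bilinear_minimax strategies_props)
  obtain \<alpha> \<beta> where "\<alpha> \<in> interior (dual_cone C)" "\<beta> \<in> interior (dual_cone K)"
    using assms(9,10) by blast
  then show ?thesis
    using minimax alternative_if_minimax[OF assms(3,6)] by meson
qed

end
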